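(* Let $G=\langle r_0,\ldots,r_{n-1}\rangle\subset GL_n(\mathbb{Z})$ be a crystallographic linear Coxeter group with string diagram, and suppose that for some modulus $s\ge2$ the reduced group $G^s$ is a string C-group (with respect to the images of $r_0,\ldots,r_{n-1}$). Let $d$ be an integer with $s\mid d$. Write $G_{n-1}=\langle r_0,\ldots,r_{n-2}\rangle$, $G_{0,n-1}=\langle r_1,\ldots,r_{n-2}\rangle$. Suppose that either (a) $G_{n-1}$ is of spherical type and the reduction map $G_{n-1}\to G_{n-1}^s$ is an isomorphism; or (b) $n\ge3$, $G_{n-1}=T\rtimes G_{0,n-1}$ is of Euclidean type with translation group $T$ and spherical point group $G_{0,n-1}$ such that the reduction map $G_{0,n-1}\to G_{0,n-1}^s$ is an isomorphism, and moreover $T^d\cap\langle r_1,\ldots,r_{n-1}\rangle^d=\{e\}$. Then $G^d$ is a string C-group.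
   Context: Setup: $V=\mathbb{R}^n$ with basis $b_0,\ldots,b_{n-1}$ (a basic system); integers $m_{ij}$ with $m_{ii}=-2$, $m_{ij}=0$ for $|i-j|\ge2$, $(m_{i-1,i},m_{i,i-1})\in\{(0,0),(1,1),(1,2),(2,1),(1,3),(3,1),(1,4),(4,1),(2,2)\}$; reflections $r_i(b_j)=b_j+m_{ij}b_i$; $G=\langle r_0,\ldots,r_{n-1}\rangle$, which preserves a symmetric bilinear form with Gram matrix determined by $m_{ij}=-2(b_i\cdot b_j)/(b_i\cdot b_i)$, $b_i\cdot b_i>0$. For a subgroup $X$ of $G$ and modulus $t$, $X^t$ denotes its image in $GL_n(\mathbb{Z}_t)$ under reduction of matrix entries mod $t$; $e$ is the identity. A subgroup generated by a set of the $r_i$ is of spherical type if the form on the span of the corresponding $b_i$ is positive definite (equivalently the subgroup is finite), and of Euclidean type if that form is positive semidefinite with $1$-dimensional radical $R$; in the Euclidean case the group acts as an affine reflection group on Euclidean space and its translation group $T$ is the set of its elements acting trivially on (span)$/R$. A string C-group is a group generated by involutions $\rho_0,\ldots,\rho_{n-1}$ with $(\rho_i\rho_j)^2=1$ for $|i-j|\ge2$ and $\langle\rho_i:i\in I\rangle\cap\langle\rho_i:i\in J\rangle=\langle\rho_i:i\in I\cap J\rangle$ for all $I,J\subseteq\{0,\ldots,n-1\}$. *)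

theory Defs
  imports
    "HOL-Algebra.Generated_Groups"
    "Jordan_Normal_Form.VS_Connect"
begin

text \<open>
  The basis \<open>b\<^sub>0, \<dots>, b\<^bsub>n-1\<^esub>\<close> identifies \<open>V\<close> with the space of real coordinate vectors of
  dimension \<open>n\<close>, and \<open>b\<^sub>i\<close> with \<open>unit_vec n i\<close>.  Only the values \<open>m i j\<close> with \<open>i, j < n\<close> matter.
  The matrix \<open>B\<close> is the Gram matrix of the invariant form; the integers \<open>m i j\<close> determine it only
  up to a positive factor on each connected component of the diagram, so it is kept as a parameter.
\<close>

definition string_crystallographic_system :: "nat \<Rightarrow> (nat \<Rightarrow> nat \<Rightarrow> int) \<Rightarrow> real mat \<Rightarrow> bool" where
  "string_crystallographic_system n m B \<longleftrightarrow>
     1 \<le> n \<and>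
     (\<forall>i<n. m i i = -2) \<and>
     (\<forall>i<n. \<forall>j<n. i + 2 \<le> j \<or> j + 2 \<le> i \<longrightarrow> m i j = 0) \<and>
     (\<forall>i<n. 1 \<le> i \<longrightarrow> (m (i - 1) i, m i (i - 1)) \<in>
        {(0,0), (1,1), (1,2), (2,1), (1,3), (3,1), (1,4), (4,1), (2,2)}) \<and>
     B \<in> carrier_mat n n \<and>
     (\<forall>i<n. \<forall>j<n. B $$ (i, j) = B $$ (j, i)) \<and>
     (\<forall>i<n. B $$ (i, i) > 0) \<and>
     (\<forall>i<n. \<forall>j<n. real_of_int (m i j) = -2 * B $$ (i, j) / B $$ (i, i))"

text \<open>Matrices act on column vectors: column \<open>j\<close> of \<open>reflection n m i\<close> is \<open>b\<^sub>j + m i j * b\<^sub>i\<close>.\<close>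

definition reflection :: "nat \<Rightarrow> (nat \<Rightarrow> nat \<Rightarrow> int) \<Rightarrow> nat \<Rightarrow> int mat" where
  "reflection n m i =
     mat n n (\<lambda>(k, j). (if k = j then 1 else 0) + (if k = i then m i j else 0))"

definition GL_int :: "nat \<Rightarrow> int mat monoid" where
  "GL_int n = units_of (ring_mat TYPE(int) n ())"

definition refl_group :: "nat \<Rightarrow> (nat \<Rightarrow> nat \<Rightarrow> int) \<Rightarrow> nat set \<Rightarrow> int mat set" where
  "refl_group n m I = generate (GL_int n) (reflection n m ` I)"

subsection \<open>Reduction modulo t\<close>

text \<open>
  A residue class mod \<open>t\<close> is represented by its canonical representative \<open>x mod t\<close>.
  For \<open>t = 0\<close> this gives the integers themselves.
\<close>

definition reduce :: "int \<Rightarrow> int mat \<Rightarrow> int mat" where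
  "reduce t A = map_mat (\<lambda>x. x mod t) A"

definition GL_mod :: "nat \<Rightarrow> int \<Rightarrow> int mat monoid" where
  "GL_mod n t = units_of
     \<lparr>carrier = {A \<in> carrier_mat n n. reduce t A = A},
      monoid.mult = (\<lambda>A B. reduce t (A * B)),
      one = reduce t (1\<^sub>m n)\<rparr>"

definition reduced_group :: "nat \<Rightarrow> int \<Rightarrow> int mat set \<Rightarrow> int mat monoid" where
  "reduced_group n t S = (GL_mod n t)\<lparr>carrier := reduce t ` S\<rparr>"

definition reduction_iso :: "nat \<Rightarrow> int \<Rightarrow> int mat set \<Rightarrow> bool" where
  "reduction_iso n t S \<longleftrightarrow> reduce t \<in> iso ((GL_int n)\<lparr>carrier := S\<rparr>) (reduced_group n t S)"

subsection \<open>String C-groups\<close>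

definition string_C_group :: "('a, 'b) monoid_scheme \<Rightarrow> nat \<Rightarrow> (nat \<Rightarrow> 'a) \<Rightarrow> bool" where
  "string_C_group H n \<rho> \<longleftrightarrow>
     group H \<and>
     \<rho> ` {..<n} \<subseteq> carrier H \<and>
     generate H (\<rho> ` {..<n}) = carrier H \<and>
     (\<forall>i<n. \<rho> i \<noteq> \<one>\<^bsub>H\<^esub> \<and> \<rho> i \<otimes>\<^bsub>H\<^esub> \<rho> i = \<one>\<^bsub>H\<^esub>) \<and>
     (\<forall>i<n. \<forall>j<n. i + 2 \<le> j \<or> j + 2 \<le> i \<longrightarrow> (\<rho> i \<otimes>\<^bsub>H\<^esub> \<rho> j) [^]\<^bsub>H\<^esub> (2::nat) = \<one>\<^bsub>H\<^esub>) \<and>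
     (\<forall>I J. I \<subseteq> {..<n} \<longrightarrow> J \<subseteq> {..<n} \<longrightarrow>
        generate H (\<rho> ` I) \<inter> generate H (\<rho> ` J) = generate H (\<rho> ` (I \<inter> J)))"

subsection \<open>Spherical and Euclidean type\<close>

definition form :: "real mat \<Rightarrow> real vec \<Rightarrow> real vec \<Rightarrow> real" where
  "form B v w = v \<bullet> (B *\<^sub>v w)"

definition basis_span :: "nat \<Rightarrow> nat set \<Rightarrow> real vec set" where
  "basis_span n I =
     LinearCombinations.module.span class_ring (module_vec TYPE(real) n) (unit_vec n ` I)"

definition radical :: "nat \<Rightarrow> real mat \<Rightarrow> nat set \<Rightarrow> real vec set" where
  "radical n B I = {v \<in> basis_span n I. \<forall>w \<in> basis_span n I. form B v w = 0}"

definition spherical_type :: "nat \<Rightarrow> real mat \<Rightarrow> nat set \<Rightarrow> bool" where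
  "spherical_type n B I \<longleftrightarrow> (\<forall>v \<in> basis_span n I. v \<noteq> 0\<^sub>v n \<longrightarrow> form B v v > 0)"

definition euclidean_type :: "nat \<Rightarrow> real mat \<Rightarrow> nat set \<Rightarrow> bool" where
  "euclidean_type n B I \<longleftrightarrow>
     (\<forall>v \<in> basis_span n I. form B v v \<ge> 0) \<and>
     vectorspace.dim class_ring ((module_vec TYPE(real) n)\<lparr>carrier := radical n B I\<rparr>) = 1"

text \<open>An element acts trivially on span/R iff it moves each vector of the span by an element of R.\<close>

definition translation_group ::
    "nat \<Rightarrow> (nat \<Rightarrow> nat \<Rightarrow> int) \<Rightarrow> real mat \<Rightarrow> nat set \<Rightarrow> int mat set" where
  "translation_group n m B I =
     {g \<in> refl_group n m I.
        \<forall>v \<in> basis_span n I. map_mat real_of_int g *\<^sub>v v - v \<in> radical n B I}"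

definition internal_semidirect :: "('a, 'b) monoid_scheme \<Rightarrow> 'a set \<Rightarrow> 'a set \<Rightarrow> bool" where
  "internal_semidirect L N H \<longleftrightarrow>
     N \<lhd> L \<and> subgroup H L \<and> N \<inter> H = {\<one>\<^bsub>L\<^esub>} \<and> N <#>\<^bsub>L\<^esub> H = carrier L"

end

theory Submission
  imports Defs
begin

text \<open>
  Let a group be generated by a sequence of elements in which non-neighbours commute.  An element
  of the subgroup given by an index set that contains the last index splits as \<open>x \<otimes> y\<close> with \<open>y\<close> in
  the subgroup of the final block of consecutive indices.  Hence the intersection property needs to
  be tested only below the last index and on the pairs \<open>{a..<p}\<close>, \<open>{k..p}\<close>.  Both tests can be
  pulled back along a homomorphism that is injective on the subgroup of \<open>{a..<p}\<close>; this settles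
  case (a), with the reduction from modulus \<open>d\<close> to modulus \<open>s\<close>.  In case (b) the same argument,
  read from both ends of the diagram, covers the subgroups omitting the first or the last
  generator, and the hypothesis on translations forces the two to meet in the image of the point
  group.
\<close>

section \<open>The intersection property relative to an index set\<close>

text \<open>For \<open>K = {..<n}\<close> this is the last clause of \<open>string_C_group\<close>.
  The set \<open>K\<close> is kept variable so that sections of the diagram can be treated before
  the whole.\<close>

definition intersection_property :: "('a, 'b) monoid_scheme \<Rightarrow> (nat \<Rightarrow> 'a) \<Rightarrow> nat set \<Rightarrow> bool" where
  "intersection_property H \<rho> K \<longleftrightarrow>
     (\<forall>I J. I \<subseteq> K \<longrightarrow> J \<subseteq> K \<longrightarrow>
        generate H (\<rho> ` I) \<inter> generate H (\<rho> ` J) = generate H (\<rho> ` (I \<inter> J)))"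

lemma intersection_propertyD:
  assumes "intersection_property H \<rho> K" "I \<subseteq> K" "J \<subseteq> K"
  shows "generate H (\<rho> ` I) \<inter> generate H (\<rho> ` J) = generate H (\<rho> ` (I \<inter> J))"
  using assms unfolding intersection_property_def by blast

lemma intersection_property_mono:
  assumes "intersection_property H \<rho> K" "L \<subseteq> K"
  shows "intersection_property H \<rho> L"
  unfolding intersection_property_def
proof (intro allI impI)
  fix I J assume "I \<subseteq> L" "J \<subseteq> L"
  then show "generate H (\<rho> ` I) \<inter> generate H (\<rho> ` J) = generate H (\<rho> ` (I \<inter> J))"
    by (intro intersection_propertyD[OF assms(1)]) (use assms(2) in auto)
qed

text \<open>Relabels generators, as needed for reversing the diagram; injectivity makes images of
  index sets commute with intersection.\<close>

lemma intersection_property_image: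
  assumes ip: "intersection_property H (\<rho> \<circ> \<sigma>) K" and inj: "inj_on \<sigma> K"
  shows "intersection_property H \<rho> (\<sigma> ` K)"
  unfolding intersection_property_def
proof (intro allI impI)
  fix I J assume "I \<subseteq> \<sigma> ` K" "J \<subseteq> \<sigma> ` K"
  then obtain I' J' where I: "I' \<subseteq> K" "I = \<sigma> ` I'" and J: "J' \<subseteq> K" "J = \<sigma> ` J'"
    by (metis subset_imageE)
  have "I \<inter> J = \<sigma> ` (I' \<inter> J')"
    using I J inj by (simp add: inj_on_image_Int)
  then show "generate H (\<rho> ` I) \<inter> generate H (\<rho> ` J) = generate H (\<rho> ` (I \<inter> J))"
    using intersection_propertyD[OF ip I(1) J(1)] I(2) J(2) by (simp add: image_comp)
qed

section \<open>Subgroups generated by commuting sets\<close>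

text \<open>The elements commuting with a fixed \<open>x\<close> are closed under products and
  inverses.\<close>

lemma (in group) generate_commute:
  assumes A: "A \<subseteq> carrier G" and x: "x \<in> carrier G"
    and comm: "\<And>a. a \<in> A \<Longrightarrow> a \<otimes> x = x \<otimes> a" and g: "g \<in> generate G A"
  shows "g \<otimes> x = x \<otimes> g"
  using g
proof induction
  case one
  then show ?case using x by simp
next
  case (incl h)
  then show ?case by (rule comm)
next
  case (inv h)
  then have h: "h \<in> carrier G" using A by blast
  have "inv h \<otimes> x = inv h \<otimes> (x \<otimes> h) \<otimes> inv h"
    using h x by (simp add: m_assoc)
  also have "\<dots> = inv h \<otimes> (h \<otimes> x) \<otimes> inv h"
    using comm[OF inv] by simp
  also have "\<dots> = x \<otimes> inv h"
    using h x by (simp add: m_assoc[symmetric])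
  finally show ?case .
next
  case (eng h1 h2)
  have h: "h1 \<in> carrier G" "h2 \<in> carrier G"
    using eng.hyps generate_in_carrier[OF A] by auto
  have "h1 \<otimes> h2 \<otimes> x = h1 \<otimes> x \<otimes> h2"
    using eng.IH(2) h x by (simp add: m_assoc)
  then show ?case
    using eng.IH(1) h x by (simp add: m_assoc)
qed

text \<open>Once the two generated subgroups commute elementwise, the products
  \<open>a \<otimes> b\<close> are closed under multiplication, so they exhaust the group generated
  by the union.\<close>

lemma (in group) generate_Un_commuting:
  assumes A: "A \<subseteq> carrier G" and B: "B \<subseteq> carrier G"
    and comm: "\<And>a b. a \<in> A \<Longrightarrow> b \<in> B \<Longrightarrow> a \<otimes> b = b \<otimes> a"
    and g: "g \<in> generate G (A \<union> B)"
  obtains a b where "a \<in> generate G A" "b \<in> generate G B" "g = a \<otimes> b"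
proof -
  \<comment> \<open>Commutation is extended one side at a time: first from \<open>B\<close> to its
    subgroup with a generator of \<open>A\<close> fixed, then from \<open>A\<close> to its
    subgroup.\<close>
  have cAB: "a \<otimes> b = b \<otimes> a" if a: "a \<in> generate G A" and b: "b \<in> generate G B" for a b
  proof -
    have "b \<otimes> x = x \<otimes> b" if "x \<in> A" for x
    proof (rule generate_commute[OF B _ _ b])
      show "x \<in> carrier G" using that A by blast
      show "y \<otimes> x = x \<otimes> y" if "y \<in> B" for y
        using comm[OF \<open>x \<in> A\<close> that] by (rule sym)
    qed
    then show ?thesis
      by (intro generate_commute[OF A generate_in_carrier[OF B b] _ a]) (rule sym)
  qed
  from g have "\<exists>a \<in> generate G A. \<exists>b \<in> generate G B. g = a \<otimes> b"
  proof induction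
    case one
    then show ?case using generate.one by force
  next
    case (incl h)
    then have "h \<in> carrier G" using A B by blast
    then show ?case
      using incl generate.one[of G A] generate.one[of G B] generate.incl[of h A G]
        generate.incl[of h B G] r_one[of h] l_one[of h] by (metis UnE)
  next
    case (inv h)
    then have "inv h \<in> carrier G" using A B by blast
    then show ?case
      using inv generate.one[of G A] generate.one[of G B] generate.inv[of h A G]
        generate.inv[of h B G] r_one[of "inv h"] l_one[of "inv h"] by (metis UnE)
  next
    case (eng h1 h2)
    then obtain a1 b1 a2 b2 where h: "a1 \<in> generate G A" "b1 \<in> generate G B" "h1 = a1 \<otimes> b1"
      "a2 \<in> generate G A" "b2 \<in> generate G B" "h2 = a2 \<otimes> b2" by blast
    have c: "a1 \<in> carrier G" "a2 \<in> carrier G" "b1 \<in> carrier G" "b2 \<in> carrier G"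
      using h generate_in_carrier A B by auto
    have "h1 \<otimes> h2 = a1 \<otimes> (b1 \<otimes> a2) \<otimes> b2"
      using h c by (simp add: m_assoc)
    also have "\<dots> = a1 \<otimes> (a2 \<otimes> b1) \<otimes> b2"
      using cAB[OF h(4,2)] by simp
    also have "\<dots> = (a1 \<otimes> a2) \<otimes> (b1 \<otimes> b2)"
      using c by (simp add: m_assoc)
    finally show ?case using generate.eng[OF h(1,4)] generate.eng[OF h(2,5)] by blast
  qed
  then show ?thesis using that by blast
qed

section \<open>Adding the last generator\<close>

text \<open>Only \<open>k > a\<close> is tested in \<open>face\<close>, since \<open>k = a\<close>
  gives the full index set, where nothing has to be shown. The proof treats first pairs in which one
  set omits \<open>p\<close> (\<open>lower\<close>), then pairs sharing a final block
  (\<open>upper\<close>), which rests on the former.\<close>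

lemma (in group) intersection_property_extend:
  fixes a p :: nat
  assumes carr: "\<rho> ` {a..p} \<subseteq> carrier G"
    and comm: "\<And>i j. i \<in> {a..p} \<Longrightarrow> j \<in> {a..p} \<Longrightarrow> i + 2 \<le> j \<Longrightarrow> \<rho> i \<otimes> \<rho> j = \<rho> j \<otimes> \<rho> i"
    and ip: "intersection_property G \<rho> {a..<p}"
    and face: "\<And>k. a < k \<Longrightarrow> k \<le> p \<Longrightarrow>
      generate G (\<rho> ` {a..<p}) \<inter> generate G (\<rho> ` {k..p}) \<subseteq> generate G (\<rho> ` {k..<p})"
  shows "intersection_property G \<rho> {a..p}"
proof -
  let ?g = "\<lambda>I. generate G (\<rho> ` I)"
  have mono: "?g I \<subseteq> ?g J" if "I \<subseteq> J" for I J
    by (rule mono_generate) (use that in blast)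
  have sub: "subgroup (?g I) G" if "I \<subseteq> {a..p}" for I
    by (rule generate_is_subgroup) (use that carr in blast)
  have below_p: "{a..<p} = {a..p} - {p}" by auto
  have decomp: "\<exists>k. a < k \<and> k \<le> p \<and> {k..p} \<subseteq> J \<and>
      (\<forall>g \<in> ?g J. \<exists>x \<in> ?g (J \<inter> {a..<k}). \<exists>y \<in> ?g {k..p}. g = x \<otimes> y)"
    if J: "J \<subseteq> {a..p}" "p \<in> J" "J \<noteq> {a..p}" for J
  proof -
    define M where "M = {a..p} - J"
    have M: "finite M" "M \<noteq> {}" using J by (auto simp: M_def)
    \<comment> \<open>The index just above the largest gap of \<open>J\<close>. The missing index
      \<open>k - 1\<close> separates the part of \<open>J\<close> below it from the final block, so
      generators from the two sides are never neighbours.\<close>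
    define k where "k = Suc (Max M)"
    have k1: "Max M \<in> M" using M by (rule Max_in)
    then have k2: "a < k" "k \<le> p" using J(2) by (auto simp: M_def k_def le_less Suc_le_eq)
    have k3: "{k..p} \<subseteq> J"
    proof
      fix i assume i: "i \<in> {k..p}"
      then have "i \<notin> M" using Max_ge[OF M(1), of i] by (auto simp: k_def)
      then show "i \<in> J" using i k2 by (auto simp: M_def)
    qed
    have un: "J = (J \<inter> {a..<k}) \<union> {k..p}" using J(1) k3 by auto
    have "\<exists>x \<in> ?g (J \<inter> {a..<k}). \<exists>y \<in> ?g {k..p}. g = x \<otimes> y" if "g \<in> ?g J" for g
    proof -
      have g: "g \<in> generate G (\<rho> ` (J \<inter> {a..<k}) \<union> \<rho> ` {k..p})"
        using that un by (metis image_Un)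
      show ?thesis
      proof (rule generate_Un_commuting[OF _ _ _ g])
        show "\<rho> ` (J \<inter> {a..<k}) \<subseteq> carrier G" "\<rho> ` {k..p} \<subseteq> carrier G"
          using J(1) k2 carr by auto
      next
        fix u v assume "u \<in> \<rho> ` (J \<inter> {a..<k})" "v \<in> \<rho> ` {k..p}"
        then obtain i j where ij: "u = \<rho> i" "v = \<rho> j" "i \<in> J" "a \<le> i" "i < k" "k \<le> j" "j \<le> p"
          by auto
        \<comment> \<open>Since \<open>i < k\<close> and \<open>i\<close> is not the gap
          \<open>k - 1\<close>, it is at most \<open>k - 2\<close>.\<close>
        then have "i \<noteq> Max M" using k1 by (auto simp: M_def)
        then have "i + 2 \<le> j" using ij by (simp add: k_def)
        then show "u \<otimes> v = v \<otimes> u" using comm[of i j] ij k2 by auto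
      qed blast
    qed
    then show ?thesis using k2 k3 by blast
  qed
  \<comment> \<open>In the essential case \<open>g = x \<otimes> y\<close> with \<open>g\<close> and
    \<open>x\<close> both in the subgroup of \<open>{a..<p}\<close>. Then \<open>y\<close> lies
    there too, \<open>face\<close> removes \<open>p\<close> from its index set, and the property
    below \<open>p\<close> applies to \<open>g\<close>.\<close>
  have lower: "?g I \<inter> ?g J \<subseteq> ?g (I \<inter> J)" if I: "I \<subseteq> {a..<p}" and J: "J \<subseteq> {a..p}" for I J
  proof (cases "p \<in> J \<and> J \<noteq> {a..p}")
    case False
    then consider "J \<subseteq> {a..<p}" | "J = {a..p}" using J unfolding below_p by blast
    then show ?thesis
    proof cases
      case 1
      then show ?thesis using intersection_propertyD[OF ip I] by blast
    next
      case 2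
      then have "I \<inter> J = I" using I by auto
      then show ?thesis by simp
    qed
  next
    case True
    then obtain k where k: "a < k" "k \<le> p" "{k..p} \<subseteq> J"
      and dec: "\<forall>g \<in> ?g J. \<exists>x \<in> ?g (J \<inter> {a..<k}). \<exists>y \<in> ?g {k..p}. g = x \<otimes> y"
      using decomp[OF J] by blast
    show ?thesis
    proof
      fix g assume g: "g \<in> ?g I \<inter> ?g J"
      then obtain x y where xy: "x \<in> ?g (J \<inter> {a..<k})" "y \<in> ?g {k..p}" "g = x \<otimes> y"
        using dec by blast
      have sl: "subgroup (?g {a..<p}) G" by (rule sub) auto
      have sJ: "subgroup (?g (J \<inter> {a..<p})) G" by (rule sub) auto
      have gl: "g \<in> ?g {a..<p}" using g mono[OF I] by blast
      have xJ: "x \<in> ?g (J \<inter> {a..<p})" using xy(1) mono[of "J \<inter> {a..<k}" "J \<inter> {a..<p}"] k(2) by fastforce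
      have xl: "x \<in> ?g {a..<p}" using xJ mono[of "J \<inter> {a..<p}" "{a..<p}"] by auto
      have xc: "x \<in> carrier G" "g \<in> carrier G" using xl gl subgroup.subset[OF sl] by auto
      have yc: "y \<in> carrier G" using xy(2) subgroup.subset[OF sub[of "{k..p}"]] k by auto
      have "y = inv x \<otimes> g" using xy(3) xc yc by (simp add: m_assoc[symmetric])
      then have "y \<in> ?g {a..<p}"
        using subgroup.m_closed[OF sl subgroup.m_inv_closed[OF sl xl] gl] by simp
      then have "y \<in> ?g {k..<p}" using face[OF k(1,2)] xy(2) by blast
      then have yJ: "y \<in> ?g (J \<inter> {a..<p})" using mono[of "{k..<p}" "J \<inter> {a..<p}"] k by fastforce
      have "g \<in> ?g (J \<inter> {a..<p})" using xy(3) subgroup.m_closed[OF sJ xJ yJ] by simp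
      then have "g \<in> ?g (I \<inter> (J \<inter> {a..<p}))"
        using g intersection_propertyD[OF ip I, of "J \<inter> {a..<p}"] by blast
      then show "g \<in> ?g (I \<inter> J)" using mono[of "I \<inter> (J \<inter> {a..<p})" "I \<inter> J"] by blast
    qed
  qed
  \<comment> \<open>Here \<open>y\<close> belongs to both subgroups, because both index sets contain
    the final block. Dividing it out leaves \<open>x\<close>, whose index set avoids
    \<open>p\<close>, so \<open>lower\<close> applies.\<close>
  have upper: "?g I \<inter> ?g J \<subseteq> ?g (I \<inter> J)"
    if I: "I \<subseteq> {a..p}" "k \<le> p" "{k..p} \<subseteq> I" and J: "J \<subseteq> {a..p}" "{k..p} \<subseteq> J" and k: "a < k"
      and dec: "\<forall>g \<in> ?g I. \<exists>x \<in> ?g (I \<inter> {a..<k}). \<exists>y \<in> ?g {k..p}. g = x \<otimes> y" for I J k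
  proof
    fix g assume g: "g \<in> ?g I \<inter> ?g J"
    then obtain x y where xy: "x \<in> ?g (I \<inter> {a..<k})" "y \<in> ?g {k..p}" "g = x \<otimes> y"
      using dec by blast
    have sJ: "subgroup (?g J) G" and sIJ: "subgroup (?g (I \<inter> J)) G"
      using sub[OF J(1)] sub[of "I \<inter> J"] I(1) by auto
    have yJ: "y \<in> ?g J" and yIJ: "y \<in> ?g (I \<inter> J)"
      using xy(2) mono[OF J(2)] mono[of "{k..p}" "I \<inter> J"] I(3) J(2) by auto
    have xc: "x \<in> carrier G" using xy(1) subgroup.subset[OF sub[of "I \<inter> {a..<k}"]] I(1) by auto
    have yc: "y \<in> carrier G" using yJ subgroup.subset[OF sJ] by blast
    have "x = g \<otimes> inv y" using xy(3) xc yc by (simp add: m_assoc)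
    then have "x \<in> ?g J"
      using g subgroup.m_closed[OF sJ _ subgroup.m_inv_closed[OF sJ yJ]] by simp
    then have "x \<in> ?g (I \<inter> {a..<k} \<inter> J)" using lower[of "I \<inter> {a..<k}" J] I J xy(1) by fastforce
    then have "x \<in> ?g (I \<inter> J)" using mono[of "I \<inter> {a..<k} \<inter> J" "I \<inter> J"] by blast
    then show "g \<in> ?g (I \<inter> J)" using xy(3) subgroup.m_closed[OF sIJ _ yIJ] by simp
  qed
  have main: "?g I \<inter> ?g J \<subseteq> ?g (I \<inter> J)" if I: "I \<subseteq> {a..p}" and J: "J \<subseteq> {a..p}" for I J
  proof -
    consider "p \<notin> I" | "p \<notin> J" | "I = {a..p}" | "J = {a..p}"
      | "p \<in> I" "p \<in> J" "I \<noteq> {a..p}" "J \<noteq> {a..p}" by blast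
    then show ?thesis
    proof cases
      case 1
      then have "I \<subseteq> {a..<p}" using I unfolding below_p by blast
      then show ?thesis using lower J by blast
    next
      case 2
      then have "J \<subseteq> {a..<p}" using J unfolding below_p by blast
      then show ?thesis using lower[of J I] I by (simp add: Int_commute)
    next
      case 3
      then have "I \<inter> J = J" using J by blast
      then show ?thesis by simp
    next
      case 4
      then have "I \<inter> J = I" using I by blast
      then show ?thesis by simp
    next
      case 5
      obtain k where k: "a < k" "k \<le> p" "{k..p} \<subseteq> I"
        "\<forall>g \<in> ?g I. \<exists>x \<in> ?g (I \<inter> {a..<k}). \<exists>y \<in> ?g {k..p}. g = x \<otimes> y"
        using decomp[OF I] 5 by blast
      obtain l where l: "a < l" "l \<le> p" "{l..p} \<subseteq> J"
        "\<forall>g \<in> ?g J. \<exists>x \<in> ?g (J \<inter> {a..<l}). \<exists>y \<in> ?g {l..p}. g = x \<otimes> y"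
        using decomp[OF J] 5 by blast
      show ?thesis
      \<comment> \<open>The shorter of the two final blocks lies in both sets, so the splitting of
        the set it comes from is used.\<close>
      proof (cases "l \<le> k")
        case True
        then have "{k..p} \<subseteq> J" using l(3) by auto
        then show ?thesis using upper[OF I k(2,3) J _ k(1,4)] by blast
      next
        case False
        then have "{l..p} \<subseteq> I" using k(3) by auto
        then show ?thesis using upper[OF J l(2,3) I _ l(1,4)] by (simp add: Int_commute)
      qed
    qed
  qed
  show ?thesis
    unfolding intersection_property_def
  proof (intro allI impI)
    fix I J assume IJ: "I \<subseteq> {a..p}" "J \<subseteq> {a..p}"
    show "?g I \<inter> ?g J = ?g (I \<inter> J)"
      using main[OF IJ] mono[of "I \<inter> J" I] mono[of "I \<inter> J" J] by blast
  qed
qed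

section \<open>Pulling the intersection property back along a homomorphism\<close>

text \<open>Injectivity on one of the two subgroups is enough: \<open>h g\<close> has a preimage
  \<open>g'\<close> in the subgroup of \<open>I \<inter> J\<close>, and both \<open>g\<close> and
  \<open>g'\<close> lie in the subgroup of \<open>I\<close>, so they agree.\<close>

lemma (in group_hom) generate_Int_lift:
  assumes carr: "\<rho> ` K \<subseteq> carrier G" and ip: "intersection_property H (h \<circ> \<rho>) K"
    and I: "I \<subseteq> K" and J: "J \<subseteq> K" and inj: "inj_on h (generate G (\<rho> ` I))"
  shows "generate G (\<rho> ` I) \<inter> generate G (\<rho> ` J) = generate G (\<rho> ` (I \<inter> J))"
proof
  have img: "generate H ((h \<circ> \<rho>) ` L) = h ` generate G (\<rho> ` L)" if "L \<subseteq> K" for L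
  proof -
    have "\<rho> ` L \<subseteq> carrier G" using that carr by blast
    then show ?thesis by (metis generate_img image_comp)
  qed
  show "generate G (\<rho> ` I) \<inter> generate G (\<rho> ` J) \<subseteq> generate G (\<rho> ` (I \<inter> J))"
  proof
    fix g assume g: "g \<in> generate G (\<rho> ` I) \<inter> generate G (\<rho> ` J)"
    then have "h g \<in> generate H ((h \<circ> \<rho>) ` (I \<inter> J))"
      using intersection_propertyD[OF ip I J] img[OF I] img[OF J] by blast
    then obtain g' where g': "g' \<in> generate G (\<rho> ` (I \<inter> J))" "h g = h g'"
      using img[of "I \<inter> J"] I by blast
    then have "g' \<in> generate G (\<rho> ` I)"
      using G.mono_generate[of "\<rho> ` (I \<inter> J)" "\<rho> ` I"] by blast
    then show "g \<in> generate G (\<rho> ` (I \<inter> J))"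
      using g g' inj by (auto dest: inj_onD)
  qed
  show "generate G (\<rho> ` (I \<inter> J)) \<subseteq> generate G (\<rho> ` I) \<inter> generate G (\<rho> ` J)"
    using G.mono_generate[of "\<rho> ` (I \<inter> J)" "\<rho> ` I"] G.mono_generate[of "\<rho> ` (I \<inter> J)" "\<rho> ` J"]
    by blast
qed

text \<open>Every pair to be tested by the extension criterion has a member inside
  \<open>{a..<p}\<close>, where \<open>h\<close> is injective.\<close>

lemma (in group_hom) intersection_property_lift_facet:
  fixes a p :: nat
  assumes carr: "\<rho> ` {a..p} \<subseteq> carrier G"
    and comm: "\<And>i j. i \<in> {a..p} \<Longrightarrow> j \<in> {a..p} \<Longrightarrow> i + 2 \<le> j \<Longrightarrow> \<rho> i \<otimes> \<rho> j = \<rho> j \<otimes> \<rho> i"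
    and ip: "intersection_property H (h \<circ> \<rho>) {a..p}"
    and inj: "inj_on h (generate G (\<rho> ` {a..<p}))"
  shows "intersection_property G \<rho> {a..p}"
proof (rule G.intersection_property_extend[OF carr comm])
  show "intersection_property G \<rho> {a..<p}"
    unfolding intersection_property_def
  proof (intro allI impI)
    fix I J assume I: "I \<subseteq> {a..<p}" and J: "J \<subseteq> {a..<p}"
    have "inj_on h (generate G (\<rho> ` I))"
      by (rule inj_on_subset[OF inj], rule G.mono_generate) (use I in blast)
    then show "generate G (\<rho> ` I) \<inter> generate G (\<rho> ` J) = generate G (\<rho> ` (I \<inter> J))"
      by (intro generate_Int_lift[OF carr ip]) (use I J in auto)
  qed
next
  fix k assume "a < k" "k \<le> p"
  then have "{a..<p} \<inter> {k..p} = {k..<p}" by auto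
  moreover have "generate G (\<rho> ` {a..<p}) \<inter> generate G (\<rho> ` {k..p})
      = generate G (\<rho> ` ({a..<p} \<inter> {k..p}))"
    by (rule generate_Int_lift[OF carr ip _ _ inj]) (use \<open>a < k\<close> in auto)
  ultimately show "generate G (\<rho> ` {a..<p}) \<inter> generate G (\<rho> ` {k..p}) \<subseteq> generate G (\<rho> ` {k..<p})"
    by simp
qed

text \<open>Obtained from the previous lemma by reversing the diagram.\<close>

lemma (in group_hom) intersection_property_lift_vertex_figure:
  fixes q :: nat
  assumes carr: "\<rho> ` {0..q} \<subseteq> carrier G"
    and comm: "\<And>i j. i \<in> {0..q} \<Longrightarrow> j \<in> {0..q} \<Longrightarrow> i + 2 \<le> j \<Longrightarrow> \<rho> i \<otimes> \<rho> j = \<rho> j \<otimes> \<rho> i"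
    and ip: "intersection_property H (h \<circ> \<rho>) {0..q}"
    and inj: "inj_on h (generate G (\<rho> ` {1..q}))"
  shows "intersection_property G \<rho> {0..q}"
proof -
  \<comment> \<open>Natural subtraction is truncated, so this is an involution only on
    \<open>{0..q}\<close>.\<close>
  define \<sigma> where "\<sigma> i = q - i" for i :: nat
  have invol: "\<sigma> (\<sigma> i) = i" if "i \<in> {0..q}" for i
    using that by (auto simp: \<sigma>_def)
  have \<sigma>1: "\<sigma> ` {0..q} = {0..q}"
  proof
    show "{0..q} \<subseteq> \<sigma> ` {0..q}"
    proof
      fix i assume "i \<in> {0..q}"
      then have "i = \<sigma> (\<sigma> i)" "\<sigma> i \<in> {0..q}" using invol by (auto simp: \<sigma>_def)
      then show "i \<in> \<sigma> ` {0..q}" by blast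
    qed
  qed (auto simp: \<sigma>_def)
  \<comment> \<open>Omitting the last index of the reversed sequence means omitting index 0 of the
    original one; this turns \<open>inj\<close> into the injectivity required for the facet.\<close>
  have \<sigma>2: "\<sigma> ` {0..<q} = {1..q}"
  proof
    show "{1..q} \<subseteq> \<sigma> ` {0..<q}"
    proof
      fix i assume "i \<in> {1..q}"
      then have "i = \<sigma> (q - i)" "q - i \<in> {0..<q}" by (auto simp: \<sigma>_def)
      then show "i \<in> \<sigma> ` {0..<q}" by blast
    qed
  qed (auto simp: \<sigma>_def)
  have \<sigma>inj: "inj_on \<sigma> {0..q}"
    by (metis inj_on_inverseI invol)
  have "intersection_property G (\<rho> \<circ> \<sigma>) {0..q}"
  proof (rule intersection_property_lift_facet)
    show "(\<rho> \<circ> \<sigma>) ` {0..q} \<subseteq> carrier G"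
      using carr \<sigma>1 by (metis image_comp)
    show "(\<rho> \<circ> \<sigma>) i \<otimes> (\<rho> \<circ> \<sigma>) j = (\<rho> \<circ> \<sigma>) j \<otimes> (\<rho> \<circ> \<sigma>) i"
      if "i \<in> {0..q}" "j \<in> {0..q}" "i + 2 \<le> j" for i j
      using comm[of "\<sigma> j" "\<sigma> i"] that by (auto simp: \<sigma>_def)
    show "inj_on h (generate G ((\<rho> \<circ> \<sigma>) ` {0..<q}))"
      using inj \<sigma>2 by (metis image_comp)
    \<comment> \<open>Reversing twice restores \<open>h \<circ> \<rho>\<close> on
      \<open>{0..q}\<close>, so relabelling by \<open>\<sigma>\<close> transfers \<open>ip\<close>
      to the sequence reversed once.\<close>
    have "intersection_property H ((h \<circ> \<rho> \<circ> \<sigma>) \<circ> \<sigma>) {0..q}"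
      unfolding intersection_property_def
    proof (intro allI impI)
      fix I J assume IJ: "I \<subseteq> {0..q}" "J \<subseteq> {0..q}"
      have "((h \<circ> \<rho> \<circ> \<sigma>) \<circ> \<sigma>) ` L = (h \<circ> \<rho>) ` L" if "L \<subseteq> {0..q}" for L
        by (rule image_cong) (use that invol in auto)
      then show "generate H ((h \<circ> \<rho> \<circ> \<sigma> \<circ> \<sigma>) ` I) \<inter> generate H ((h \<circ> \<rho> \<circ> \<sigma> \<circ> \<sigma>) ` J)
          = generate H ((h \<circ> \<rho> \<circ> \<sigma> \<circ> \<sigma>) ` (I \<inter> J))"
        using intersection_propertyD[OF ip IJ] IJ by (simp add: le_infI1)
    qed
    then show "intersection_property H (h \<circ> (\<rho> \<circ> \<sigma>)) {0..q}"
      using intersection_property_image[OF _ \<sigma>inj] \<sigma>1 by (metis comp_assoc)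
  qed
  then show ?thesis
    using intersection_property_image[OF _ \<sigma>inj] \<sigma>1 by metis
qed

section \<open>Matrix groups over the integers and modulo t\<close>

lemma reduce_carrier [simp]: "reduce t A \<in> carrier_mat k l \<longleftrightarrow> A \<in> carrier_mat k l"
  by (auto simp: reduce_def)

lemma reduce_reduce: "s dvd t \<Longrightarrow> reduce s (reduce t A) = reduce s A"
  by (rule eq_matI) (auto simp: reduce_def mod_mod_cancel)

lemma reduce_mult:
  assumes A: "A \<in> carrier_mat n n" and B: "B \<in> carrier_mat n n"
  shows "reduce t (reduce t A * reduce t B) = reduce t (A * B)"
proof (rule eq_matI)
  fix i j assume "i < dim_row (reduce t (A * B))" "j < dim_col (reduce t (A * B))"
  then have ij: "i < n" "j < n" using A B by (auto simp: reduce_def)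
  have "(\<Sum>k<n. (A $$ (i, k) mod t) * (B $$ (k, j) mod t)) mod t
      = (\<Sum>k<n. (A $$ (i, k) mod t) * (B $$ (k, j) mod t) mod t) mod t"
    by (rule mod_sum_eq[symmetric])
  also have "\<dots> = (\<Sum>k<n. A $$ (i, k) * B $$ (k, j) mod t) mod t"
    by (simp add: mod_mult_eq)
  also have "\<dots> = (\<Sum>k<n. A $$ (i, k) * B $$ (k, j)) mod t"
    by (rule mod_sum_eq)
  finally show "reduce t (reduce t A * reduce t B) $$ (i, j) = reduce t (A * B) $$ (i, j)"
    using A B ij by (simp add: reduce_def scalar_prod_def atLeast0LessThan)
qed (use A B in \<open>auto simp: reduce_def\<close>)

lemma reduce_mult_left:
  assumes "A \<in> carrier_mat n n" "B \<in> carrier_mat n n"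
  shows "reduce t (reduce t A * B) = reduce t (A * B)"
  using reduce_mult[of "reduce t A" n B t] reduce_mult[OF assms, of t] assms
  by (simp add: reduce_reduce)

lemma reduce_mult_right:
  assumes "A \<in> carrier_mat n n" "B \<in> carrier_mat n n"
  shows "reduce t (A * reduce t B) = reduce t (A * B)"
  using reduce_mult[of A n "reduce t B" t] reduce_mult[OF assms, of t] assms
  by (simp add: reduce_reduce)

text \<open>The monoid whose unit group is \<open>GL_mod n t\<close>.\<close>

abbreviation mat_mod :: "nat \<Rightarrow> int \<Rightarrow> int mat monoid" where
  "mat_mod n t \<equiv>
     \<lparr>carrier = {A \<in> carrier_mat n n. reduce t A = A},
      monoid.mult = (\<lambda>A B. reduce t (A * B)),
      one = reduce t (1\<^sub>m n)\<rparr>"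

lemma monoid_mat_mod: "monoid (mat_mod n t)"
proof (rule monoidI)
  fix x y z assume "x \<in> carrier (mat_mod n t)" "y \<in> carrier (mat_mod n t)" "z \<in> carrier (mat_mod n t)"
  then show "x \<otimes>\<^bsub>mat_mod n t\<^esub> y \<otimes>\<^bsub>mat_mod n t\<^esub> z = x \<otimes>\<^bsub>mat_mod n t\<^esub> (y \<otimes>\<^bsub>mat_mod n t\<^esub> z)"
    using reduce_mult_left[of "x * y" n z t] reduce_mult_right[of x n "y * z" t]
      mult_carrier_mat[of x n n y n] mult_carrier_mat[of y n n z n]
    by (simp add: assoc_mult_mat[of x n n y n z n])
qed (auto simp: reduce_reduce reduce_mult_left[of _ n] reduce_mult_right[of _ n])

lemma group_GL_mod: "group (GL_mod n t)"
  unfolding GL_mod_def by (rule monoid.units_group[OF monoid_mat_mod])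

lemma GL_mod_mult: "A \<otimes>\<^bsub>GL_mod n t\<^esub> B = reduce t (A * B)"
  by (simp add: GL_mod_def units_of_mult)

lemma GL_mod_one: "\<one>\<^bsub>GL_mod n t\<^esub> = reduce t (1\<^sub>m n)"
  by (simp add: GL_mod_def units_of_one)

lemma GL_mod_carrier_iff:
  "A \<in> carrier (GL_mod n t) \<longleftrightarrow> A \<in> carrier_mat n n \<and> reduce t A = A \<and>
     (\<exists>B \<in> carrier_mat n n. reduce t B = B \<and> reduce t (A * B) = reduce t (1\<^sub>m n)
        \<and> reduce t (B * A) = reduce t (1\<^sub>m n))"
  by (auto simp: GL_mod_def units_of_carrier Units_def)

lemma reduce_zero [simp]: "reduce 0 A = A"
  by (rule eq_matI) (auto simp: reduce_def)

text \<open>Since every integer divides 0, reduction of integer matrices becomes an instance of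
  reduction from a modulus to one of its divisors.\<close>

lemma GL_int_eq_GL_mod: "GL_int n = GL_mod n 0"
  by (simp add: GL_int_def GL_mod_def units_of_def Units_def ring_mat_def)

lemma group_hom_reduce:
  assumes "s dvd d"
  shows "group_hom (GL_mod n d) (GL_mod n s) (reduce s)"
proof -
  have mult: "reduce s (reduce s A * reduce s B) = reduce s (reduce d (A * B))"
    if "A \<in> carrier_mat n n" "B \<in> carrier_mat n n" for A B
    using that by (simp add: reduce_reduce[OF assms] reduce_mult)
  have "reduce s A \<in> carrier (GL_mod n s)" if "A \<in> carrier (GL_mod n d)" for A
  proof -
    from that obtain B where A: "A \<in> carrier_mat n n" and B: "B \<in> carrier_mat n n"
      and AB: "reduce d (A * B) = reduce d (1\<^sub>m n)" "reduce d (B * A) = reduce d (1\<^sub>m n)"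
      unfolding GL_mod_carrier_iff by blast
    \<comment> \<open>An inverse modulo \<open>d\<close>, reduced further, is an inverse modulo
      \<open>s\<close>.\<close>
    have "reduce s (reduce s A * reduce s B) = reduce s (1\<^sub>m n)"
      "reduce s (reduce s B * reduce s A) = reduce s (1\<^sub>m n)"
      using mult[OF A B] mult[OF B A] AB by (simp_all add: reduce_reduce[OF assms])
    then show ?thesis
      unfolding GL_mod_carrier_iff using A B
      by (auto simp: reduce_reduce intro!: bexI[of _ "reduce s B"])
  qed
  then have "reduce s \<in> hom (GL_mod n d) (GL_mod n s)"
    by (auto simp: hom_def GL_mod_mult GL_mod_carrier_iff mult)
  then show ?thesis
    by (simp add: group_hom_def group_hom_axioms_def group_GL_mod)
qed

section \<open>The reflections and their relations\<close>

lemma reflection_carrier_mat: "reflection n m i \<in> carrier_mat n n"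
  by (simp add: reflection_def)

text \<open>A reflection is the identity plus a matrix supported in one row, so the product has four
  terms, and only the last mixes the two reflections.\<close>

lemma reflection_mult_index:
  assumes "i < n" "j < n" "k < n" "l < n"
  shows "(reflection n m i * reflection n m j) $$ (k, l)
    = (if k = l then 1 else 0) + (if k = j then m j l else 0)
      + (if k = i then m i l + m i j * m j l else 0)"
proof -
  have "(reflection n m i * reflection n m j) $$ (k, l)
    = (\<Sum>x<n. ((if k = x then 1 else 0) + (if k = i then m i x else 0))
        * ((if x = l then 1 else 0) + (if x = j then m j l else 0)))"
    using assms by (simp add: reflection_def scalar_prod_def atLeast0LessThan)
  \<comment> \<open>Each summand now tests the summation variable against one fixed index, so every
    sum collapses to a single term.\<close>
  also have "\<dots> = (\<Sum>x<n. (if x = k then (if k = l then 1 else 0) else 0)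
      + (if x = k then (if k = j then m j l else 0) else 0)
      + (if x = l then (if k = i then m i l else 0) else 0)
      + (if x = j then (if k = i then m i j * m j l else 0) else 0))"
    by (rule sum.cong) (auto simp: algebra_simps)
  also have "\<dots> = (if k = l then 1 else 0) + (if k = j then m j l else 0)
      + (if k = i then m i l + m i j * m j l else 0)"
    using assms by (simp add: sum.distrib)
  finally show ?thesis .
qed

text \<open>The correction in row \<open>i\<close> is \<open>2 * m i l + m i i * m i l\<close>,
  which vanishes.\<close>

lemma reflection_square:
  assumes "i < n" "m i i = -2"
  shows "reflection n m i * reflection n m i = 1\<^sub>m n"
proof (rule eq_matI)
  fix k l assume "k < dim_row (1\<^sub>m n :: int mat)" "l < dim_col (1\<^sub>m n :: int mat)"
  then show "(reflection n m i * reflection n m i) $$ (k, l) = 1\<^sub>m n $$ (k, l)"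
    using assms by (simp add: reflection_mult_index del: index_mult_mat(1))
qed (simp_all add: reflection_def)

lemma reflection_commute:
  assumes "i < n" "j < n" "i \<noteq> j" "m i j = 0" "m j i = 0"
  shows "reflection n m i * reflection n m j = reflection n m j * reflection n m i"
proof (rule eq_matI)
  fix k l assume "k < dim_row (reflection n m j * reflection n m i)"
    "l < dim_col (reflection n m j * reflection n m i)"
  then have "k < n" "l < n" by (simp_all add: reflection_def)
  then show "(reflection n m i * reflection n m j) $$ (k, l)
      = (reflection n m j * reflection n m i) $$ (k, l)"
    using assms by (simp add: reflection_mult_index del: index_mult_mat(1))
qed (simp_all add: reflection_def)

text \<open>The modulus precedes the index, so \<open>refl_mod n m t\<close> is a sequence of
  generators.\<close>

definition refl_mod :: "nat \<Rightarrow> (nat \<Rightarrow> nat \<Rightarrow> int) \<Rightarrow> int \<Rightarrow> nat \<Rightarrow> int mat" where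
  "refl_mod n m t i = reduce t (reflection n m i)"

lemma reduced_reflection:
  assumes sys: "string_crystallographic_system n m B"
  defines "\<rho> \<equiv> refl_mod n m"
  shows "i < n \<Longrightarrow> \<rho> t i \<in> carrier (GL_mod n t)"
    and "i < n \<Longrightarrow> \<rho> t i \<otimes>\<^bsub>GL_mod n t\<^esub> \<rho> t i = \<one>\<^bsub>GL_mod n t\<^esub>"
    and "i < n \<Longrightarrow> j < n \<Longrightarrow> i + 2 \<le> j \<or> j + 2 \<le> i \<Longrightarrow>
      \<rho> t i \<otimes>\<^bsub>GL_mod n t\<^esub> \<rho> t j = \<rho> t j \<otimes>\<^bsub>GL_mod n t\<^esub> \<rho> t i"
proof -
  have sq: "reflection n m i * reflection n m i = 1\<^sub>m n" if "i < n" for i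
    by (rule reflection_square) (use sys that in \<open>simp_all add: string_crystallographic_system_def\<close>)
  have prod: "\<rho> t i \<otimes>\<^bsub>GL_mod n t\<^esub> \<rho> t j = reduce t (reflection n m i * reflection n m j)" for i j
    by (simp add: GL_mod_mult \<rho>_def refl_mod_def reduce_mult[of _ n] reflection_carrier_mat)
  show sq': "\<rho> t i \<otimes>\<^bsub>GL_mod n t\<^esub> \<rho> t i = \<one>\<^bsub>GL_mod n t\<^esub>" if "i < n"
    using sq[OF that] by (simp add: prod GL_mod_one)
  show "\<rho> t i \<in> carrier (GL_mod n t)" if "i < n"
  proof -
    have "\<rho> t i \<in> carrier_mat n n" "reduce t (\<rho> t i) = \<rho> t i"
      by (simp_all add: \<rho>_def refl_mod_def reduce_reduce reflection_carrier_mat)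
    \<comment> \<open>Being an involution, the reflection is its own witness for
      invertibility.\<close>
    moreover have "reduce t (\<rho> t i * \<rho> t i) = reduce t (1\<^sub>m n)"
      using sq'[OF that] unfolding GL_mod_mult GL_mod_one .
    ultimately show ?thesis
      unfolding GL_mod_carrier_iff by blast
  qed
  show "\<rho> t i \<otimes>\<^bsub>GL_mod n t\<^esub> \<rho> t j = \<rho> t j \<otimes>\<^bsub>GL_mod n t\<^esub> \<rho> t i"
    if "i < n" "j < n" "i + 2 \<le> j \<or> j + 2 \<le> i"
  proof -
    have "m i j = 0" "m j i = 0" "i \<noteq> j"
      using sys that unfolding string_crystallographic_system_def by auto
    then show ?thesis
      using reflection_commute[of i n j m] that(1,2) by (simp add: prod)
  qed
qed

section \<open>Reduced reflection groups as string C-groups\<close>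

lemma reduce_refl_group:
  assumes sys: "string_crystallographic_system n m B" and I: "I \<subseteq> {..<n}"
  shows "reduce t ` refl_group n m I = generate (GL_mod n t) (refl_mod n m t ` I)"
proof -
  interpret red: group_hom "GL_mod n 0" "GL_mod n t" "reduce t"
    by (rule group_hom_reduce) simp
  have "reflection n m ` I \<subseteq> carrier (GL_mod n 0)"
    using reduced_reflection(1)[OF sys, of _ 0] I by (auto simp: refl_mod_def)
  then show ?thesis
    unfolding refl_group_def GL_int_eq_GL_mod
    by (simp add: red.generate_img[symmetric] image_image refl_mod_def[abs_def])
qed

text \<open>The relations hold modulo every \<open>t\<close> and generation holds by construction.
  Nontriviality has to stay as a condition: for \<open>n = 1\<close> the reflection becomes the
  identity modulo 2.\<close>

lemma string_C_group_reduced_iff: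
  assumes sys: "string_crystallographic_system n m B"
  defines "\<rho> \<equiv> refl_mod n m"
  shows "string_C_group (reduced_group n t (refl_group n m {..<n})) n (\<rho> t) \<longleftrightarrow>
    (\<forall>i<n. \<rho> t i \<noteq> \<one>\<^bsub>GL_mod n t\<^esub>) \<and> intersection_property (GL_mod n t) (\<rho> t) {..<n}"
proof -
  interpret G: group "GL_mod n t" by (rule group_GL_mod)
  note refl = reduced_reflection[OF sys, folded \<rho>_def]
  define S where "S = generate (GL_mod n t) (\<rho> t ` {..<n})"
  have carr: "\<rho> t ` {..<n} \<subseteq> carrier (GL_mod n t)" using refl(1) by blast
  have S: "subgroup S (GL_mod n t)" unfolding S_def by (rule G.generate_is_subgroup[OF carr])
  have inS: "\<rho> t ` I \<subseteq> S" if "I \<subseteq> {..<n}" for I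
    unfolding S_def using that by (auto intro: generate.incl)
  have R: "reduced_group n t (refl_group n m {..<n}) = (GL_mod n t)\<lparr>carrier := S\<rparr>"
    by (simp add: reduced_group_def S_def \<rho>_def reduce_refl_group[OF sys])
  have gen: "generate ((GL_mod n t)\<lparr>carrier := S\<rparr>) (\<rho> t ` I) = generate (GL_mod n t) (\<rho> t ` I)"
    if "I \<subseteq> {..<n}" for I
    by (rule G.generate_consistent[OF inS[OF that] S])
  have pow: "(\<rho> t i \<otimes>\<^bsub>GL_mod n t\<^esub> \<rho> t j) [^]\<^bsub>GL_mod n t\<lparr>carrier := S\<rparr>\<^esub> (2::nat) = \<one>\<^bsub>GL_mod n t\<^esub>"
    if ij: "i < n" "j < n" "i + 2 \<le> j \<or> j + 2 \<le> i" for i j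
  proof -
    have c: "\<rho> t i \<in> carrier (GL_mod n t)" "\<rho> t j \<in> carrier (GL_mod n t)"
      using refl(1) ij by auto
    have "(\<rho> t i \<otimes>\<^bsub>GL_mod n t\<^esub> \<rho> t j) \<otimes>\<^bsub>GL_mod n t\<^esub> (\<rho> t i \<otimes>\<^bsub>GL_mod n t\<^esub> \<rho> t j)
        = (\<rho> t i \<otimes>\<^bsub>GL_mod n t\<^esub> \<rho> t j) \<otimes>\<^bsub>GL_mod n t\<^esub> (\<rho> t j \<otimes>\<^bsub>GL_mod n t\<^esub> \<rho> t i)"
      using refl(3)[OF ij] by simp
    also have "\<dots> = \<rho> t i \<otimes>\<^bsub>GL_mod n t\<^esub> (\<rho> t j \<otimes>\<^bsub>GL_mod n t\<^esub> \<rho> t j) \<otimes>\<^bsub>GL_mod n t\<^esub> \<rho> t i"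
      using c by (simp add: G.m_assoc)
    also have "\<dots> = \<one>\<^bsub>GL_mod n t\<^esub>"
      using refl(2)[OF ij(1)] refl(2)[OF ij(2)] c by simp
    finally show ?thesis
      using c by (simp add: numeral_2_eq_2 nat_pow_def)
  qed
  have "intersection_property ((GL_mod n t)\<lparr>carrier := S\<rparr>) (\<rho> t) {..<n}
      \<longleftrightarrow> intersection_property (GL_mod n t) (\<rho> t) {..<n}"
    unfolding intersection_property_def by (simp add: gen le_infI1)
  moreover have "group ((GL_mod n t)\<lparr>carrier := S\<rparr>)"
    by (rule G.subgroup_imp_group[OF S])
  moreover have "generate ((GL_mod n t)\<lparr>carrier := S\<rparr>) (\<rho> t ` {..<n}) = S"
    using gen[of "{..<n}"] by (simp add: S_def)
  ultimately show ?thesis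
    unfolding R string_C_group_def intersection_property_def[symmetric]
    using inS[of "{..<n}"] refl(2)[of _ t] pow by simp
qed

section \<open>Passage from modulus \<open>s\<close> to modulus \<open>d\<close>\<close>

theorem theorem6p1:
  fixes n :: nat and m :: "nat \<Rightarrow> nat \<Rightarrow> int" and B :: "real mat" and s d :: int
  assumes "string_crystallographic_system n m B"
    and "s \<ge> 2"
    and "string_C_group (reduced_group n s (refl_group n m {..<n})) n
           (\<lambda>i. reduce s (reflection n m i))"
    and "s dvd d"
    and "(spherical_type n B {..<n - 1} \<and>
            reduction_iso n s (refl_group n m {..<n - 1}))
       \<or> (n \<ge> 3 \<and>
            euclidean_type n B {..<n - 1} \<and>
            internal_semidirect ((GL_int n)\<lparr>carrier := refl_group n m {..<n - 1}\<rparr>)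
              (translation_group n m B {..<n - 1}) (refl_group n m {1..<n - 1}) \<and>
            spherical_type n B {1..<n - 1} \<and>
            reduction_iso n s (refl_group n m {1..<n - 1}) \<and>
            reduce d ` translation_group n m B {..<n - 1} \<inter> reduce d ` refl_group n m {1..<n}
              = {\<one>\<^bsub>GL_mod n d\<^esub>})"
  shows "string_C_group (reduced_group n d (refl_group n m {..<n})) n
           (\<lambda>i. reduce d (reflection n m i))"
proof -
  note sys = assms(1)
  define \<rho> where "\<rho> = refl_mod n m"
  interpret red: group_hom "GL_mod n d" "GL_mod n s" "reduce s"
    by (rule group_hom_reduce[OF assms(4)])
  note refl = reduced_reflection[OF sys, folded \<rho>_def]
  have iff: "string_C_group (reduced_group n t (refl_group n m {..<n})) n (\<lambda>i. reduce t (reflection n m i))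
      \<longleftrightarrow> (\<forall>i<n. \<rho> t i \<noteq> \<one>\<^bsub>GL_mod n t\<^esub>) \<and> intersection_property (GL_mod n t) (\<rho> t) {..<n}" for t
    using string_C_group_reduced_iff[OF sys, of t] by (simp add: \<rho>_def refl_mod_def[abs_def])
  let ?g = "\<lambda>I. generate (GL_mod n d) (\<rho> d ` I)"
  \<comment> \<open>\<open>p\<close> is the index of the last generator, so \<open>{0..<p}\<close>
    describes the facet group.\<close>
  obtain p where n: "n = Suc p"
    using sys unfolding string_crystallographic_system_def by (cases n) auto
  have red\<rho>: "reduce s \<circ> \<rho> d = \<rho> s"
    using assms(4) by (auto simp: \<rho>_def refl_mod_def reduce_reduce)
  have s: "intersection_property (GL_mod n s) (\<rho> s) {..<n}"
    "i < n \<Longrightarrow> \<rho> s i \<noteq> \<one>\<^bsub>GL_mod n s\<^esub>" for i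
    using assms(3) unfolding iff by blast+
  have ip: "intersection_property (GL_mod n s) (reduce s \<circ> \<rho> d) {a..b}" if "b < n" for a b
    unfolding red\<rho> by (rule intersection_property_mono[OF s(1)]) (use that in auto)
  have carr: "\<rho> d ` {a..b} \<subseteq> carrier (GL_mod n d)" if "b < n" for a b
    using that refl(1) by auto
  have comm: "\<rho> d i \<otimes>\<^bsub>GL_mod n d\<^esub> \<rho> d j = \<rho> d j \<otimes>\<^bsub>GL_mod n d\<^esub> \<rho> d i"
    if "i < n" "j < n" "i + 2 \<le> j" for i j
    using refl(3) that by blast
  have reduce_gen: "reduce d ` refl_group n m I = ?g I" if "I \<subseteq> {..<n}" for I
    using reduce_refl_group[OF sys that, of d] by (simp add: \<rho>_def)
  \<comment> \<open>Reduction modulo \<open>s\<close> factors through reduction modulo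
    \<open>d\<close>; if the composite is injective on the integral group, the second factor is
    injective on the image of the first.\<close>
  have inj: "inj_on (reduce s) (?g I)"
    if I: "I \<subseteq> {..<n}" and iso: "reduction_iso n s (refl_group n m I)" for I
  proof -
    have "inj_on (reduce s) (refl_group n m I)"
      using iso by (simp add: reduction_iso_def iso_def bij_betw_def)
    then show ?thesis
      unfolding reduce_gen[OF I, symmetric]
      by (auto simp: inj_on_def reduce_reduce[OF assms(4)])
  qed
  have main: "intersection_property (GL_mod n d) (\<rho> d) {0..p}"
    using assms(5)
  proof (elim disjE conjE)
    assume iso: "reduction_iso n s (refl_group n m {..<n - 1})"
    have "inj_on (reduce s) (?g {0..<p})"
      using inj[OF _ iso] n by (simp add: atLeast0LessThan subset_eq)
    then show ?thesis
      by (intro red.intersection_property_lift_facet[OF carr comm ip]) (use n in auto)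
  next
    let ?T = "translation_group n m B {..<n - 1}"
    assume n3: "n \<ge> 3" and iso: "reduction_iso n s (refl_group n m {1..<n - 1})"
      and semi: "internal_semidirect ((GL_int n)\<lparr>carrier := refl_group n m {..<n - 1}\<rparr>)
              ?T (refl_group n m {1..<n - 1})"
      and triv: "reduce d ` ?T \<inter> reduce d ` refl_group n m {1..<n} = {\<one>\<^bsub>GL_mod n d\<^esub>}"
    \<comment> \<open>Injectivity on the point group serves twice: \<open>{1..<p}\<close> is
      \<open>{1..p}\<close> without its last index, and also \<open>{0..<p}\<close> without its
      first.\<close>
    have inj1: "inj_on (reduce s) (?g {1..<p})"
      using inj[OF _ iso] n by (simp add: subset_eq)
    have facet: "intersection_property (GL_mod n d) (\<rho> d) {1..p}"
      by (rule red.intersection_property_lift_facet[OF carr comm ip inj1]) (use n in auto)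
    obtain q where q: "p = Suc q" using n n3 by (cases p) auto
    have "inj_on (reduce s) (?g {1..q})"
      using inj1 q by (simp add: atLeastLessThanSuc_atLeastAtMost)
    then have vertex_figure: "intersection_property (GL_mod n d) (\<rho> d) {0..q}"
      by (intro red.intersection_property_lift_vertex_figure[OF carr comm ip]) (use n q in auto)
    \<comment> \<open>An element of the left side is a reduced translation times a reduced point
      group element. The second factor lies in the subgroup of \<open>{1..p}\<close>, hence so does
      the first, and \<open>triv\<close> makes it the identity.\<close>
    have meet: "?g {0..<p} \<inter> ?g {1..p} \<subseteq> ?g {1..<p}"
    proof
      fix g assume g: "g \<in> ?g {0..<p} \<inter> ?g {1..p}"
      interpret int: group_hom "GL_mod n 0" "GL_mod n d" "reduce d"
        by (rule group_hom_reduce) simp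
      have sub: "refl_group n m I \<subseteq> carrier (GL_mod n 0)" if "I \<subseteq> {..<n}" for I
        unfolding refl_group_def GL_int_eq_GL_mod
        by (rule int.G.generate_incl) (use reduced_reflection(1)[OF sys, of _ 0] that in \<open>auto simp: refl_mod_def\<close>)
      have "g \<in> reduce d ` refl_group n m {..<n - 1}"
        using g reduce_gen[of "{..<n - 1}"] n by (auto simp: atLeast0LessThan)
      then obtain w where w: "w \<in> refl_group n m {..<n - 1}" "g = reduce d w" by blast
      then have "w \<in> ?T <#>\<^bsub>GL_mod n 0\<^esub> refl_group n m {1..<n - 1}"
        using semi by (simp add: internal_semidirect_def set_mult_def GL_int_eq_GL_mod)
      then obtain t h where th: "t \<in> ?T" "h \<in> refl_group n m {1..<n - 1}"
        "w = t \<otimes>\<^bsub>GL_mod n 0\<^esub> h"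
        by (auto simp: set_mult_def)
      have thc: "t \<in> carrier (GL_mod n 0)" "h \<in> carrier (GL_mod n 0)"
        using th(1,2) sub[of "{1..<p}"] sub[of "{..<p}"] n by (auto simp: translation_group_def subset_eq)
      have g_eq: "g = reduce d t \<otimes>\<^bsub>GL_mod n d\<^esub> reduce d h"
        using w(2) th(3) int.hom_mult[OF thc] by simp
      have c: "reduce d t \<in> carrier (GL_mod n d)" "reduce d h \<in> carrier (GL_mod n d)"
        using thc by simp_all
      have h: "reduce d h \<in> ?g {1..<p}"
        using th(2) reduce_gen[of "{1..<p}"] n by (auto simp: subset_eq)
      then have h1: "reduce d h \<in> ?g {1..p}"
        using red.G.mono_generate[of "\<rho> d ` {1..<p}" "\<rho> d ` {1..p}"] by (auto simp: subset_eq)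
      have sg: "subgroup (?g {1..p}) (GL_mod n d)"
        by (rule red.G.generate_is_subgroup) (use carr n in auto)
      have "reduce d t = g \<otimes>\<^bsub>GL_mod n d\<^esub> inv\<^bsub>GL_mod n d\<^esub> reduce d h"
        using g_eq c by (simp add: red.G.m_assoc)
      then have "reduce d t \<in> ?g {1..p}"
        using g subgroup.m_closed[OF sg _ subgroup.m_inv_closed[OF sg h1]] by simp
      then have "reduce d t \<in> reduce d ` refl_group n m {1..<n}"
        using reduce_gen[of "{1..<n}"] n by (simp add: atLeastLessThanSuc_atLeastAtMost subset_eq)
      then have "reduce d t = \<one>\<^bsub>GL_mod n d\<^esub>"
        using triv th(1) by blast
      then show "g \<in> ?g {1..<p}"
        using g_eq h c by simp
    qed
    show ?thesis
    proof (rule red.G.intersection_property_extend[OF carr comm])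
      show "intersection_property (GL_mod n d) (\<rho> d) {0..<p}"
        using vertex_figure q by (simp add: atLeastLessThanSuc_atLeastAtMost)
      \<comment> \<open>As \<open>k\<close> is at least 1, the subgroup of \<open>{k..p}\<close>
        sits in that of \<open>{1..p}\<close>. So \<open>meet\<close> puts the intersection into the
        point group, and \<open>facet\<close> finishes.\<close>
      fix k :: nat assume k: "0 < k" "k \<le> p"
      then have "{1..<p} \<inter> {k..p} = {k..<p}" by auto
      then have "?g {1..<p} \<inter> ?g {k..p} = ?g {k..<p}"
        using intersection_propertyD[OF facet, of "{1..<p}" "{k..p}"] k by (simp add: subset_eq)
      moreover have "?g {k..p} \<subseteq> ?g {1..p}"
        by (rule red.G.mono_generate) (use k in auto)
      ultimately show "?g {0..<p} \<inter> ?g {k..p} \<subseteq> ?g {k..<p}"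
        using meet by blast
    qed (use n in auto)
  qed
  \<comment> \<open>A generator trivial modulo \<open>d\<close> would be trivial modulo
    \<open>s\<close>.\<close>
  have "\<rho> d i \<noteq> \<one>\<^bsub>GL_mod n d\<^esub>" if "i < n" for i
    using s(2)[OF that] red\<rho> red.hom_one by (metis comp_apply)
  moreover have "{0..p} = {..<n}" using n by auto
  ultimately show ?thesis
    using main unfolding iff by simp
qed

end
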